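(* Let $n,N\in\mathbb{N}$, let $m_{k,\ell}\in\mathbb{N}\cup\{0\}$ for $k=1,\ldots,n$ and $\ell=0,\ldots,N-1$, and let $a_{k,j_0,\ldots,j_{N-1}}$ be analytic functions in the unit disc $\mathbb{D}$ for $k=1,\ldots,n$ and $0\le j_\ell\le m_{k,\ell}$ ($\ell=0,\ldots,N-1$). Let $M_0,\ldots,M_{N-1}\in\mathbb{N}\cup\{0\}$ be such that $$M_0\ge\max_{k=1,\ldots,n}\frac{m_{k,0}}{k}-2\quad\text{and}\quad M_\ell\ge\max_{k=1,\ldots,n}\frac{m_{k,\ell}}{k}-1,\quad \ell=1,\ldots,N-1.$$ Then there exists a constant $C>0$, depending only on $n$, $N$, the numbers $m_{k,\ell}$ and the numbers $M_\ell$, such that each meromorphic solution $f$ in $\mathbb{D}$ of $$\left(f^{(N)}\right)^n+\sum_{k=1}^{n}P_{k,N}(f)\left(f^{(N)}\right)^{n-k}=0,\qquad P_{k,N}(f)=\sum_{j_0=0}^{m_{k,0}}\sum_{j_1=0}^{m_{k,1}}\cdots\sum_{j_{N-1}=0}^{m_{k,N-1}}a_{k,j_0,\ldots,j_{N-1}}\prod_{\ell=0}^{N-1}\left(f^{(\ell)}\right)^{j_\ell},$$ satisfies, at every point of $\mathbb{D}$, $$\prod_{\ell=0}^{N-1}\left(\left(f^{(\ell)}\right)^{M_\ell+1}\right)^{\#}\le C\sum_{k=1}^n\left(\sum_{j_0=0}^{m_{k,0}}\sum_{j_1=0}^{m_{k,1}}\cdots\sum_{j_{N-1}=0}^{m_{k,N-1}}|a_{k,j_0,\ldots,j_{N-1}}|^{\frac1k}\right).$$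 In particular (case $N=1$): if $m_1,\ldots,m_n\in\mathbb{N}\cup\{0\}$, $a_{k,j}$ are analytic in $\mathbb{D}$ for $k=1,\ldots,n$, $j=0,\ldots,m_k$, and $M_0\in\mathbb{N}\cup\{0\}$ satisfies $\max_{k=1,\ldots,n}\frac{m_k}{k}\le M_0+2$, then there is a constant $C>0$ depending only on $n$, $m_1,\ldots,m_n$ and $M_0$ such that each meromorphic solution $f$ in $\mathbb{D}$ of $$(f')^n+\sum_{k=1}^{n}\left(\sum_{j=0}^{m_k}a_{k,j}f^j\right)(f')^{n-k}=0$$ satisfies, at every point of $\mathbb{D}$, $$\left(f^{M_0+1}\right)^{\#}\le C\sum_{k=1}^n\sum_{j=0}^{m_k}|a_{k,j}|^{\frac1k}.$$
   Context: $\mathbb{D}=\{z\in\mathbb{C}:|z|<1\}$ and $\mathbb{N}=\{1,2,\ldots\}$. For a function $g$ meromorphic in $\mathbb{D}$, $g^{\#}=\frac{|g'|}{1+|g|^2}$ denotes the spherical derivative, extended continuously to the poles of $g$. $f^{(\ell)}$ is the $\ell$-th derivative, with $f^{(0)}=f$; zeroth powers are identically $1$. In $(f^{(\ell)})^{M_\ell+1}$ the exponent denotes the ordinary power of the function $f^{(\ell)}$. A meromorphic solution is a meromorphic function in $\mathbb{D}$ satisfying the equation as an identity of meromorphic functions. *)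

theory Defs
  imports "HOL-Complex_Analysis.Complex_Analysis"
begin

definition spherical_deriv :: "(complex \<Rightarrow> complex) \<Rightarrow> complex \<Rightarrow> real" where
  "spherical_deriv g z =
     (if is_pole g z then Lim (at z) (\<lambda>w. norm (deriv g w) / (1 + (norm (g w))\<^sup>2))
      else norm (deriv g z) / (1 + (norm (g z))\<^sup>2))"

text \<open>
  A tuple \<open>(j\<^sub>0, \<dots>, j\<^bsub>N-1\<^esub>)\<close> with \<open>0 \<le> j\<^sub>l \<le> \<mu> l\<close> is represented by an extensional
  function on \<open>{..<N}\<close>, so that distinct elements of this set are distinct tuples.
\<close>
definition multi_indices :: "nat \<Rightarrow> (nat \<Rightarrow> nat) \<Rightarrow> (nat \<Rightarrow> nat) set" where
  "multi_indices N \<mu> = Pi\<^sub>E {..<N} (\<lambda>l. {..\<mu> l})"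

definition diff_poly ::
  "nat \<Rightarrow> (nat \<Rightarrow> nat) \<Rightarrow> ((nat \<Rightarrow> nat) \<Rightarrow> complex \<Rightarrow> complex) \<Rightarrow>
   (complex \<Rightarrow> complex) \<Rightarrow> complex \<Rightarrow> complex" where
  "diff_poly N \<mu> c f z =
     (\<Sum>j\<in>multi_indices N \<mu>. c j z * (\<Prod>l<N. ((deriv ^^ l) f z) ^ (j l)))"

text \<open>
  A meromorphic function is represented by a function with
  \<open>f nicely_meromorphic_on ball 0 1\<close>, that is, one that is analytic away from its poles
  (with the library's dummy value 0 at the poles). The iterated derivatives of such an \<open>f\<close>
  are analytic off the poles of \<open>f\<close>, so an identity between meromorphic functions built
  from them is a pointwise identity at all points that are not poles of \<open>f\<close>.
\<close>
definition meromorphic_solution ::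
  "nat \<Rightarrow> nat \<Rightarrow> (nat \<Rightarrow> nat \<Rightarrow> nat) \<Rightarrow> (nat \<Rightarrow> (nat \<Rightarrow> nat) \<Rightarrow> complex \<Rightarrow> complex) \<Rightarrow>
   (complex \<Rightarrow> complex) \<Rightarrow> bool" where
  "meromorphic_solution n N m a f \<longleftrightarrow>
     f nicely_meromorphic_on ball 0 1 \<and>
     (\<forall>z\<in>ball 0 1. \<not> is_pole f z \<longrightarrow>
        ((deriv ^^ N) f z) ^ n
          + (\<Sum>k=1..n. diff_poly N (m k) (a k) f z * ((deriv ^^ N) f z) ^ (n - k)) = 0)"

definition meromorphic_solution_first_order ::
  "nat \<Rightarrow> (nat \<Rightarrow> nat) \<Rightarrow> (nat \<Rightarrow> nat \<Rightarrow> complex \<Rightarrow> complex) \<Rightarrow> (complex \<Rightarrow> complex) \<Rightarrow> bool" where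
  "meromorphic_solution_first_order n m a f \<longleftrightarrow>
     f nicely_meromorphic_on ball 0 1 \<and>
     (\<forall>z\<in>ball 0 1. \<not> is_pole f z \<longrightarrow>
        (deriv f z) ^ n
          + (\<Sum>k=1..n. (\<Sum>j=0..m k. a k j z * (f z) ^ j) * (deriv f z) ^ (n - k)) = 0)"

end

theory Submission imports Defs begin

text \<open>
  At a point that is not a pole of \<open>f\<close>, a polynomial root bound followed by subadditivity of
  the \<open>k\<close>-th root estimates \<open>\<bar>f\<^bsup>(N)\<^esup>\<bar>\<close> by the sum of the terms
  \<open>\<bar>a\<bar>\<^bsup>1/k\<^esup> \<Prod> \<bar>f\<^bsup>(l)\<^esup>\<bar>\<^bsup>j l/k\<^esup>\<close>. The numerators of the spherical derivatives
  multiply to a constant times \<open>\<bar>f\<bar>\<^bsup>M 0\<^esup> \<Prod> \<bar>f\<^bsup>(l)\<^esup>\<bar>\<^bsup>M l + 1\<^esup> \<bar>f\<^bsup>(N)\<^esup>\<bar>\<close>, with the product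
  over \<open>1 \<le> l < N\<close>, because the factor \<open>\<bar>f\<^bsup>(l+1)\<^esup>\<bar>\<close> coming from index \<open>l\<close> can be
  attributed to index \<open>l + 1\<close>. The hypotheses on \<open>M\<close> say exactly that the resulting exponent
  of \<open>\<bar>f\<^bsup>(l)\<^esup>\<bar>\<close> is at most the exponent \<open>2 (M l + 1)\<close> in the \<open>l\<close>-th denominator. Poles
  are reached by continuity.
\<close>

section \<open>Root bounds for polynomials and elementary inequalities\<close>

lemma norm_poly_root_le:
  fixes y :: "'a :: real_normed_field"
  assumes "y ^ n + (\<Sum>k=1..n. c k * y ^ (n - k)) = 0"
  shows "norm y \<le> (\<Sum>k=1..n. root k (norm (c k)))"
proof (rule ccontr)
  define Y where "Y = norm y"
  \<comment> \<open>If the bound fails, these ratios sum to less than 1. Taking norms in the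
    equation and dividing by \<open>Y ^ n\<close> bounds 1 by the sum of the \<open>t k ^ k\<close>,
    hence by the sum of the \<open>t k\<close>, since each lies in [0, 1].\<close>
  define t where "t k = root k (norm (c k)) / Y" for k
  assume "\<not> ?thesis"
  then have less: "(\<Sum>k=1..n. root k (norm (c k))) < Y" by (simp add: Y_def)
  moreover have "0 \<le> (\<Sum>k=1..n. root k (norm (c k)))" by (intro sum_nonneg) auto
  ultimately have "Y > 0" by linarith
  have t0: "t k \<ge> 0" for k
    using \<open>Y > 0\<close> by (cases "k = 0") (auto simp: t_def)
  have t_sum: "(\<Sum>k=1..n. t k) < 1"
    using less \<open>Y > 0\<close> by (simp add: t_def flip: sum_divide_distrib)
  have t1: "t k \<le> 1" if "k \<in> {1..n}" for k
    using member_le_sum[of k "{1..n}" t] that t0 t_sum by auto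
  have "y ^ n = - (\<Sum>k=1..n. c k * y ^ (n - k))"
    using assms by (simp add: eq_neg_iff_add_eq_0)
  then have "Y ^ n = norm (\<Sum>k=1..n. c k * y ^ (n - k))"
    by (metis Y_def norm_minus_cancel norm_power)
  also have "\<dots> \<le> (\<Sum>k=1..n. norm (c k) * Y ^ (n - k))"
    by (rule order_trans[OF norm_sum]) (simp add: norm_mult norm_power Y_def)
  also have "\<dots> = (\<Sum>k=1..n. t k ^ k * Y ^ n)"
  proof (rule sum.cong)
    fix k assume "k \<in> {1..n}"
    then have "norm (c k) = (t k * Y) ^ k"
      using \<open>Y > 0\<close> by (simp add: t_def)
    moreover have "Y ^ n = Y ^ k * Y ^ (n - k)"
      using \<open>k \<in> _\<close> by (simp flip: power_add)
    ultimately show "norm (c k) * Y ^ (n - k) = t k ^ k * Y ^ n"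
      by (simp add: power_mult_distrib)
  qed simp
  also have "\<dots> \<le> (\<Sum>k=1..n. t k * Y ^ n)"
    using \<open>Y > 0\<close> t0 t1
    by (intro sum_mono mult_right_mono) (auto simp: power_decreasing[of 1, simplified])
  also have "\<dots> < Y ^ n"
    using t_sum \<open>Y > 0\<close> by (simp flip: sum_distrib_right)
  finally show False by simp
qed

lemma root_add_le:
  assumes "k > 0" "x \<ge> 0" "y \<ge> 0"
  shows "root k (x + y) \<le> root k x + root k y"
proof -
  \<comment> \<open>Superadditivity of the k-th power, applied to two roots, is subadditivity of the
    root.\<close>
  have super: "u ^ k + v ^ k \<le> (u + v) ^ k" if "u \<ge> 0" "v \<ge> 0" for u v :: real
    using \<open>k > 0\<close>
  proof (induction k rule: nat_induct_non_zero)
    case (Suc k)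
    have "u ^ Suc k + v ^ Suc k \<le> u * (u + v) ^ k + v * (u + v) ^ k"
      using that by (auto intro!: add_mono mult_left_mono power_mono)
    then show ?case by (simp add: algebra_simps)
  qed simp
  have "x + y \<le> (root k x + root k y) ^ k"
    using super[of "root k x" "root k y"] assms by simp
  then have "root k (x + y) \<le> root k ((root k x + root k y) ^ k)"
    using assms by simp
  then show ?thesis
    using assms by (simp add: real_root_power_cancel)
qed

lemma root_sum_le:
  assumes "k > 0" "\<And>i. i \<in> A \<Longrightarrow> f i \<ge> 0"
  shows "root k (\<Sum>i\<in>A. f i) \<le> (\<Sum>i\<in>A. root k (f i))"
  using assms(2)
proof (induction A rule: infinite_finite_induct)
  case (insert i A)
  then have "root k (f i + sum f A) \<le> root k (f i) + root k (sum f A)"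
    using assms(1) by (intro root_add_le sum_nonneg) auto
  also have "\<dots> \<le> root k (f i) + (\<Sum>i\<in>A. root k (f i))"
    using insert by auto
  finally show ?case using insert by simp
qed auto

lemma root_prod:
  "k > 0 \<Longrightarrow> root k (\<Prod>i\<in>A. f i) = (\<Prod>i\<in>A. root k (f i))"
  by (induction A rule: infinite_finite_induct) (auto simp: real_root_mult)

text \<open>For positive x the left side is x to the exponent e + j/k, which is at most D. The
  constant 1 absorbs the range x \<le> 1, and \<open>x ^ D\<close> absorbs the rest. The right side
  has the shape of the denominator of a spherical derivative.\<close>

lemma power_mult_root_le:
  fixes x :: real
  assumes "k > 0" "x \<ge> 0" "j \<le> k * d" "e + d = D"
  shows "x ^ e * root k (x ^ j) \<le> 1 + x ^ D"
proof (cases "x \<le> 1")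
  case True
  have "x ^ e * root k (x ^ j) \<le> 1 * 1"
    using assms True by (intro mult_mono) (auto intro: power_le_one)
  then show ?thesis using assms by (simp add: add_increasing2)
next
  case False
  have "root k (x ^ j) \<le> root k ((x ^ d) ^ k)"
    using assms False
    by (auto simp: power_mult[symmetric] mult.commute intro!: power_increasing)
  also have "\<dots> = x ^ d"
    using assms by (simp add: real_root_power_cancel)
  finally have "x ^ e * root k (x ^ j) \<le> x ^ e * x ^ d"
    using assms by (intro mult_left_mono) auto
  then show ?thesis using assms by (auto simp flip: power_add)
qed

section \<open>Poles and spherical derivatives of powers\<close>

lemma is_pole_power:
  fixes f :: "complex \<Rightarrow> complex"
  assumes "is_pole f z" "n > 0"
  shows "is_pole (\<lambda>w. f w ^ n) z"
  using assms unfolding is_pole_def filterlim_at_infinity_conv_norm_at_top norm_power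
  by (intro filterlim_pow_at_top)

lemma is_pole_higher_deriv:
  assumes "f meromorphic_on {z}" "is_pole f z"
  shows "is_pole ((deriv ^^ l) f) z"
proof (induction l)
  case (Suc l)
  then show ?case
    using is_pole_deriv_iff[OF meromorphic_on_higher_deriv[OF assms(1), of l]] by simp
qed (use assms in simp)

text \<open>
  The limit in \<^const>\<open>spherical_deriv\<close> is a genuine one: away from the pole the
  spherical derivative of \<open>g\<close> agrees with that of \<open>1 / g\<close>, which is analytic there.
\<close>
lemma tendsto_spherical_deriv_at_pole:
  assumes "g meromorphic_on {z}" "is_pole g z"
  shows "((\<lambda>w. norm (deriv g w) / (1 + (norm (g w))\<^sup>2)) \<longlongrightarrow> spherical_deriv g z) (at z)"
proof -
  have "isolated_singularity_at g z"
    using assms(1) by (simp add: meromorphic_at_iff)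
  then obtain r1 where r1: "r1 > 0" "g analytic_on ball z r1 - {z}"
    by (auto simp: isolated_singularity_at_def)
  obtain r2 where r2: "r2 > 0" "\<And>w. w \<in> ball z r2 - {z} \<Longrightarrow> g w \<noteq> 0"
    using non_zero_neighbour_pole[OF assms(2)]
    unfolding eventually_at by (metis DiffE UNIV_I dist_commute insertCI mem_ball)
  define B where "B = ball z (min r1 r2)"
  have B: "open B" "z \<in> B" "g holomorphic_on B - {z}" "\<forall>w\<in>B - {z}. g w \<noteq> 0"
    using r1 r2 by (auto simp: B_def intro!: analytic_imp_holomorphic analytic_on_subset[OF r1(2)])
  \<comment> \<open>The value 0 at z is imposed because the value of g at its pole is arbitrary; it
    makes h the analytic extension of 1/g.\<close>
  define h where "h = (\<lambda>w. if w = z then 0 else inverse (g w))"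
  have h: "h holomorphic_on B"
    unfolding h_def using B assms(2) by (intro is_pole_inverse_holomorphic) auto
  have eq: "norm (deriv h w) / (1 + (norm (h w))\<^sup>2) = norm (deriv g w) / (1 + (norm (g w))\<^sup>2)"
    if w: "w \<in> B - {z}" for w
  proof -
    have "g field_differentiable at w" "g w \<noteq> 0"
      using B w holomorphic_on_imp_differentiable_at[OF B(3), of w] by auto
    moreover have "deriv h w = deriv (\<lambda>w. inverse (g w)) w"
    proof (rule deriv_cong_ev[OF _ refl])
      have "eventually (\<lambda>v. v \<in> B - {z}) (nhds w)"
        using w B(1) by (intro eventually_nhds_in_open) auto
      then show "eventually (\<lambda>v. h v = inverse (g v)) (nhds w)"
        by eventually_elim (auto simp: h_def)
    qed
    ultimately have "norm (deriv h w) = norm (deriv g w) / (norm (g w))\<^sup>2"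
      by (simp add: deriv_inverse norm_divide norm_power)
    moreover have "norm (h w) = 1 / norm (g w)"
      using w by (simp add: h_def norm_inverse divide_inverse)
    \<comment> \<open>The squared norm of \<open>g w\<close> dividing the numerator also divides out
      of the denominator, so inversion preserves the quotient.\<close>
    moreover have "(norm (g w))\<^sup>2 * (1 + (1 / norm (g w))\<^sup>2) = 1 + (norm (g w))\<^sup>2"
      using \<open>g w \<noteq> 0\<close> by (simp add: power_divide distrib_left)
    ultimately show ?thesis by simp
  qed
  have "h analytic_on {z}"
    using h B(1,2) analytic_at by blast
  then have "isCont h z" "isCont (deriv h) z"
    by (auto intro: analytic_at_imp_isCont analytic_deriv)
  then have "((\<lambda>w. norm (deriv h w) / (1 + (norm (h w))\<^sup>2))
      \<longlongrightarrow> norm (deriv h z) / (1 + (norm (h z))\<^sup>2)) (at z)"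
    unfolding isCont_def
    by (intro tendsto_intros) (auto simp: add_nonneg_eq_0_iff)
  moreover have "eventually (\<lambda>w. norm (deriv h w) / (1 + (norm (h w))\<^sup>2) =
      norm (deriv g w) / (1 + (norm (g w))\<^sup>2)) (at z)"
    using eventually_at_in_open[OF B(1,2)] by eventually_elim (rule eq)
  ultimately have lim: "((\<lambda>w. norm (deriv g w) / (1 + (norm (g w))\<^sup>2))
      \<longlongrightarrow> norm (deriv h z) / (1 + (norm (h z))\<^sup>2)) (at z)"
    by (rule Lim_transform_eventually)
  then show ?thesis
    using assms(2) tendsto_Lim[OF _ lim] by (simp add: spherical_deriv_def)
qed

text \<open>Poles are isolated, so near z the quotient in the preceding limit is the spherical
  derivative itself. The positive exponent \<open>Suc p\<close> ensures that the power still has a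
  pole.\<close>

lemma tendsto_spherical_deriv_power_at_pole:
  assumes "g meromorphic_on {z}" "is_pole g z"
  shows "(spherical_deriv (\<lambda>w. g w ^ Suc p) \<longlongrightarrow> spherical_deriv (\<lambda>w. g w ^ Suc p) z) (at z)"
proof -
  define q where "q = (\<lambda>w. g w ^ Suc p)"
  have q: "q meromorphic_on {z}" "is_pole q z"
    unfolding q_def using assms by (intro meromorphic_on_power is_pole_power; simp)+
  then have "eventually (\<lambda>w. \<not> is_pole q w) (at z)"
    by (intro eventually_not_pole) (simp add: meromorphic_at_iff)
  then have "eventually (\<lambda>w. norm (deriv q w) / (1 + (norm (q w))\<^sup>2) = spherical_deriv q w) (at z)"
    by eventually_elim (simp add: spherical_deriv_def)
  with tendsto_spherical_deriv_at_pole[OF q] show ?thesis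
    unfolding q_def by (rule Lim_transform_eventually)
qed

lemma spherical_deriv_power:
  assumes "g analytic_on {z}"
  shows "spherical_deriv (\<lambda>w. g w ^ Suc p) z =
    real (Suc p) * (norm (g z) ^ p * norm (deriv g z)) / (1 + norm (g z) ^ (2 * Suc p))"
proof -
  have "\<not> is_pole (\<lambda>w. g w ^ Suc p) z"
    using assms by (intro analytic_at_imp_no_pole analytic_intros)
  moreover have "deriv (\<lambda>w. g w ^ Suc p) z = of_nat (Suc p) * (g z ^ p * deriv g z)"
    using analytic_derivI[OF assms]
    by (intro DERIV_imp_deriv DERIV_cong[OF DERIV_power]) auto
  moreover have "(norm (g z ^ Suc p))\<^sup>2 = norm (g z) ^ (2 * Suc p)"
    by (metis norm_power power_mult mult.commute)
  ultimately show ?thesis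
    by (simp add: spherical_deriv_def norm_mult norm_power del: of_nat_Suc power_Suc)
qed

section \<open>The estimate at points where \<open>f\<close> is analytic\<close>

lemma norm_diff_poly_root_le:
  assumes "k > 0"
  shows "root k (norm (diff_poly N \<mu> c f z)) \<le>
    (\<Sum>j\<in>multi_indices N \<mu>. norm (c j z) powr (1 / real k) *
       (\<Prod>l<N. root k (norm ((deriv ^^ l) f z) ^ j l)))"
proof -
  have "root k (norm (diff_poly N \<mu> c f z)) \<le>
      root k (\<Sum>j\<in>multi_indices N \<mu>. norm (c j z * (\<Prod>l<N. ((deriv ^^ l) f z) ^ j l)))"
    using assms by (simp add: diff_poly_def norm_sum)
  also have "\<dots> \<le>
      (\<Sum>j\<in>multi_indices N \<mu>. root k (norm (c j z * (\<Prod>l<N. ((deriv ^^ l) f z) ^ j l))))"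
    using assms by (intro root_sum_le) auto
  also have "\<dots> = (\<Sum>j\<in>multi_indices N \<mu>. norm (c j z) powr (1 / real k) *
       (\<Prod>l<N. root k (norm ((deriv ^^ l) f z) ^ j l)))"
    using assms
    by (simp add: norm_mult real_root_mult root_powr_inverse[symmetric] root_prod
        norm_power flip: prod_norm)
  finally show ?thesis .
qed

lemma spherical_deriv_prod_le_at_regular_point:
  fixes m :: "nat \<Rightarrow> nat \<Rightarrow> nat"
  assumes "f analytic_on {z}"
    and eq: "((deriv ^^ N) f z) ^ n
      + (\<Sum>k=1..n. diff_poly N (m k) (a k) f z * ((deriv ^^ N) f z) ^ (n - k)) = 0"
    and "N \<ge> 1"
    and M0: "\<And>k. k \<in> {1..n} \<Longrightarrow> m k 0 \<le> k * (M 0 + 2)"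
    and Ml: "\<And>k l. k \<in> {1..n} \<Longrightarrow> l \<in> {1..<N} \<Longrightarrow> m k l \<le> k * (M l + 1)"
  shows "(\<Prod>l<N. spherical_deriv (\<lambda>w. ((deriv ^^ l) f w) ^ (M l + 1)) z) \<le>
    (\<Prod>l<N. real (M l + 1)) *
      (\<Sum>k=1..n. \<Sum>j\<in>multi_indices N (m k). norm (a k j z) powr (1 / real k))"
proof -
  define x where "x l = norm ((deriv ^^ l) f z)" for l
  \<comment> \<open>Exponent of \<open>x l\<close> in the combined numerators: \<open>M l\<close>
    from differentiating the power at index l, plus one from the derivative at index l - 1. Index 0
    has no predecessor, which is why \<open>M 0\<close> has the weaker hypothesis.\<close>
  define e where "e l = M l + (if l = 0 then 0 else 1)" for l
  define D where "D l = 1 + x l ^ (2 * (M l + 1))" for l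
  define K where "K = (\<Prod>l<N. real (M l + 1))"
  have x0: "x l \<ge> 0" and D0: "D l > 0" for l
    by (auto simp: x_def D_def add_pos_nonneg)
  \<comment> \<open>Reindexing leaves over only \<open>x N\<close>, the norm of the highest
    derivative, which the differential equation controls.\<close>
  have shift: "(\<Prod>l<N. x (Suc l)) = (\<Prod>l<N. x l ^ (if l = 0 then 0 else 1)) * x N"
    using \<open>N \<ge> 1\<close> by (induction N rule: dec_induct) auto
  have "(\<Prod>l<N. spherical_deriv (\<lambda>w. ((deriv ^^ l) f w) ^ (M l + 1)) z) =
      (\<Prod>l<N. real (M l + 1) * (x l ^ M l * x (Suc l)) / D l)"
    using spherical_deriv_power[OF analytic_higher_deriv[OF assms(1)]]
    by (simp add: x_def D_def)
  also have "\<dots> = K * ((\<Prod>l<N. x l ^ M l) * (\<Prod>l<N. x (Suc l))) / (\<Prod>l<N. D l)"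
    by (simp only: prod_dividef prod.distrib K_def)
  also have "\<dots> = K * ((\<Prod>l<N. x l ^ e l) * x N) / (\<Prod>l<N. D l)"
    unfolding shift by (simp add: e_def power_add prod.distrib)
  finally have prod_eq: "(\<Prod>l<N. spherical_deriv (\<lambda>w. ((deriv ^^ l) f w) ^ (M l + 1)) z) =
      K * ((\<Prod>l<N. x l ^ e l) * x N) / (\<Prod>l<N. D l)" .
  have "x N \<le> (\<Sum>k=1..n. root k (norm (diff_poly N (m k) (a k) f z)))"
    unfolding x_def by (rule norm_poly_root_le[OF eq])
  also have "\<dots> \<le> (\<Sum>k=1..n. \<Sum>j\<in>multi_indices N (m k).
      norm (a k j z) powr (1 / real k) * (\<Prod>l<N. root k (x l ^ j l)))"
    unfolding x_def by (intro sum_mono norm_diff_poly_root_le) auto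
  finally have "(\<Prod>l<N. x l ^ e l) * x N \<le> (\<Prod>l<N. x l ^ e l) *
      (\<Sum>k=1..n. \<Sum>j\<in>multi_indices N (m k).
      norm (a k j z) powr (1 / real k) * (\<Prod>l<N. root k (x l ^ j l)))"
    using x0 by (intro mult_left_mono prod_nonneg) auto
  also have "\<dots> = (\<Sum>k=1..n. \<Sum>j\<in>multi_indices N (m k).
      norm (a k j z) powr (1 / real k) * (\<Prod>l<N. x l ^ e l * root k (x l ^ j l)))"
    by (simp add: sum_distrib_left prod.distrib mult.left_commute)
  also have "\<dots> \<le> (\<Sum>k=1..n. \<Sum>j\<in>multi_indices N (m k).
      norm (a k j z) powr (1 / real k) * (\<Prod>l<N. D l))"
  proof (intro sum_mono mult_left_mono prod_mono conjI)
    fix k j l assume k: "k \<in> {1..n}" and j: "j \<in> multi_indices N (m k)" and l: "l \<in> {..<N}"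
    have "j l \<le> m k l"
      using j l by (auto simp: multi_indices_def PiE_iff)
    \<comment> \<open>The factor after k is \<open>2 * (M l + 1) - e l\<close>, exactly the room
      left below the degree of \<open>D l\<close>.\<close>
    also have "\<dots> \<le> k * (if l = 0 then M l + 2 else M l + 1)"
      using M0[OF k] Ml[OF k, of l] l by auto
    finally show "x l ^ e l * root k (x l ^ j l) \<le> D l"
      unfolding D_def using k x0 by (intro power_mult_root_le) (auto simp: e_def)
    show "0 \<le> x l ^ e l * root k (x l ^ j l)"
      using x0 k by simp
  qed simp
  \<comment> \<open>The product of the \<open>D l\<close> is precisely the product of the
    denominators, so no value of \<open>f\<close> survives on the right.\<close>
  finally have "(\<Prod>l<N. x l ^ e l) * x N / (\<Prod>l<N. D l) \<le>
      (\<Sum>k=1..n. \<Sum>j\<in>multi_indices N (m k). norm (a k j z) powr (1 / real k))"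
    using D0 by (simp add: pos_divide_le_eq prod_pos sum_distrib_right)
  then have "K * ((\<Prod>l<N. x l ^ e l) * x N / (\<Prod>l<N. D l)) \<le>
      K * (\<Sum>k=1..n. \<Sum>j\<in>multi_indices N (m k). norm (a k j z) powr (1 / real k))"
    by (intro mult_left_mono) (simp_all add: K_def prod_nonneg)
  then show ?thesis
    unfolding prod_eq by (simp add: K_def)
qed

section \<open>Extension of the estimate to the poles of \<open>f\<close>\<close>

lemma spherical_deriv_prod_le:
  fixes m :: "nat \<Rightarrow> nat \<Rightarrow> nat"
  assumes sol: "meromorphic_solution n N m a f"
    and an: "\<And>k j. k \<in> {1..n} \<Longrightarrow> j \<in> multi_indices N (m k) \<Longrightarrow> a k j analytic_on ball 0 1"
    and "N \<ge> 1"
    and M0: "\<And>k. k \<in> {1..n} \<Longrightarrow> m k 0 \<le> k * (M 0 + 2)"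
    and Ml: "\<And>k l. k \<in> {1..n} \<Longrightarrow> l \<in> {1..<N} \<Longrightarrow> m k l \<le> k * (M l + 1)"
    and z: "z \<in> ball 0 1"
  shows "(\<Prod>l<N. spherical_deriv (\<lambda>w. ((deriv ^^ l) f w) ^ (M l + 1)) z) \<le>
    (\<Prod>l<N. real (M l + 1)) *
      (\<Sum>k=1..n. \<Sum>j\<in>multi_indices N (m k). norm (a k j z) powr (1 / real k))"
    (is "?L z \<le> ?R z")
proof -
  have nice: "f nicely_meromorphic_on ball 0 1"
    using sol by (simp add: meromorphic_solution_def)
  have regular: "?L w \<le> ?R w" if "w \<in> ball 0 1" "\<not> is_pole f w" for w
    using sol that nicely_meromorphic_on_imp_analytic_at[OF nice that] assms(3-5)
    by (intro spherical_deriv_prod_le_at_regular_point)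
      (auto simp: meromorphic_solution_def)
  show ?thesis
  proof (cases "is_pole f z")
    case True
    have mero: "f meromorphic_on {z}"
      using nice z by (auto simp: nicely_meromorphic_on_def intro: meromorphic_on_subset)
    \<comment> \<open>All derivatives of \<open>f\<close> share the pole at z, so every factor
      converges to its own value there.\<close>
    have "(?L \<longlongrightarrow> ?L z) (at z)"
      using tendsto_spherical_deriv_power_at_pole[OF meromorphic_on_higher_deriv
          is_pole_higher_deriv] mero True
      by (intro tendsto_prod) simp
    moreover have "(?R \<longlongrightarrow> ?R z) (at z)"
    proof (intro tendsto_mult tendsto_const tendsto_sum)
      fix k j assume kj: "k \<in> {1..n}" "j \<in> multi_indices N (m k)"
      have "a k j analytic_on {z}"
        using an[OF kj] z analytic_on_analytic_at by blast
      then have "(a k j \<longlongrightarrow> a k j z) (at z)"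
        using analytic_at_imp_isCont isContD by blast
      \<comment> \<open>The form with \<open>root k\<close> is continuous even where the coefficient
        vanishes.\<close>
      then have "((\<lambda>w. root k (norm (a k j w))) \<longlongrightarrow> root k (norm (a k j z))) (at z)"
        by (intro tendsto_intros)
      then show "((\<lambda>w. norm (a k j w) powr (1 / real k)) \<longlongrightarrow>
          norm (a k j z) powr (1 / real k)) (at z)"
        using kj by (simp add: root_powr_inverse)
    qed
    moreover have "eventually (\<lambda>w. ?L w \<le> ?R w) (at z)"
    proof -
      have "eventually (\<lambda>w. \<not> is_pole f w) (at z)"
        using mero by (intro eventually_not_pole) (simp add: meromorphic_at_iff)
      moreover have "eventually (\<lambda>w. w \<in> ball 0 1) (at z)"
        using z by (intro eventually_at_in_open') auto
      ultimately show ?thesis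
        by eventually_elim (rule regular)
    qed
    ultimately show ?thesis
      by (intro tendsto_le[of "at z" ?R _ ?L]) auto
  qed (use regular z in blast)
qed

section \<open>The first-order case and the final constants\<close>

lemma sum_multi_indices_one:
  "(\<Sum>j\<in>multi_indices 1 \<mu>. F (j 0)) = (\<Sum>i=0..\<mu> 0. F i)"
proof (rule sum.reindex_bij_betw, rule bij_betwI')
  fix i j assume "i \<in> multi_indices 1 \<mu>" "j \<in> multi_indices 1 \<mu>"
  then show "i 0 = j 0 \<longleftrightarrow> i = j"
    \<comment> \<open>Extensionality makes a one-entry tuple determined by its value at 0.\<close>
    by (auto simp: multi_indices_def intro: PiE_ext)
next
  fix j assume "j \<in> multi_indices 1 \<mu>"
  then show "j 0 \<in> {0..\<mu> 0}"
    by (auto simp: multi_indices_def)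
next
  fix i assume "i \<in> {0..\<mu> 0}"
  then show "\<exists>j\<in>multi_indices 1 \<mu>. i = j 0"
    by (intro bexI[of _ "\<lambda>l\<in>{..<1}. i"]) (auto simp: multi_indices_def)
qed

lemma meromorphic_solution_first_order_iff:
  "meromorphic_solution_first_order n m a f \<longleftrightarrow>
   meromorphic_solution n 1 (\<lambda>k l. m k) (\<lambda>k j. a k (j 0)) f"
  using sum_multi_indices_one[where \<mu> = "\<lambda>l. m k" and F = "\<lambda>i. a k i z * f z ^ i" for k z]
  by (simp add: meromorphic_solution_first_order_def meromorphic_solution_def diff_poly_def)

lemma Max_ratio_leD:
  assumes "Max ((\<lambda>k. real (m k) / real k) ` {1..n}) \<le> real d" "k \<in> {1..n}"
  shows "m k \<le> k * d"
proof -
  have "real (m k) / real k \<le> real d"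
    using assms(2) by (intro order_trans[OF Max_ge assms(1)]) auto
  then have "real (m k) \<le> real (k * d)"
    using assms(2) by (simp add: field_simps)
  then show ?thesis by (simp only: of_nat_le_iff)
qed

theorem theorem1:
  "(\<forall>(n::nat) (N::nat) (m :: nat \<Rightarrow> nat \<Rightarrow> nat) (M :: nat \<Rightarrow> nat).
      n \<ge> 1 \<and> N \<ge> 1 \<and>
      real (M 0) \<ge> Max ((\<lambda>k. real (m k 0) / real k) ` {1..n}) - 2 \<and>
      (\<forall>l\<in>{1..<N}. real (M l) \<ge> Max ((\<lambda>k. real (m k l) / real k) ` {1..n}) - 1)
      \<longrightarrow>
      (\<exists>C::real. C > 0 \<and>
        (\<forall>(a :: nat \<Rightarrow> (nat \<Rightarrow> nat) \<Rightarrow> complex \<Rightarrow> complex) (f :: complex \<Rightarrow> complex).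
           (\<forall>k\<in>{1..n}. \<forall>j\<in>multi_indices N (m k). a k j analytic_on ball 0 1) \<and>
           meromorphic_solution n N m a f
           \<longrightarrow>
           (\<forall>z\<in>ball 0 1.
              (\<Prod>l<N. spherical_deriv (\<lambda>w. ((deriv ^^ l) f w) ^ (M l + 1)) z)
                \<le> C * (\<Sum>k=1..n. \<Sum>j\<in>multi_indices N (m k).
                          norm (a k j z) powr (1 / real k))))))
   \<and>
   (\<forall>(n::nat) (m :: nat \<Rightarrow> nat) (M\<^sub>0 :: nat).
      n \<ge> 1 \<and> Max ((\<lambda>k. real (m k) / real k) ` {1..n}) \<le> real M\<^sub>0 + 2
      \<longrightarrow>
      (\<exists>C::real. C > 0 \<and>
        (\<forall>(a :: nat \<Rightarrow> nat \<Rightarrow> complex \<Rightarrow> complex) (f :: complex \<Rightarrow> complex).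
           (\<forall>k\<in>{1..n}. \<forall>j\<in>{0..m k}. a k j analytic_on ball 0 1) \<and>
           meromorphic_solution_first_order n m a f
           \<longrightarrow>
           (\<forall>z\<in>ball 0 1.
              spherical_deriv (\<lambda>w. (f w) ^ (M\<^sub>0 + 1)) z
                \<le> C * (\<Sum>k=1..n. \<Sum>j=0..m k. norm (a k j z) powr (1 / real k))))))"
proof (intro conjI allI impI, goal_cases)
  case (1 n N m M)
  have "m k 0 \<le> k * (M 0 + 2)" if "k \<in> {1..n}" for k
    using 1 that by (intro Max_ratio_leD[of "\<lambda>k. m k 0" n]) (simp_all only: of_nat_add of_nat_numeral diff_le_eq)
  moreover have "m k l \<le> k * (M l + 1)" if "k \<in> {1..n}" "l \<in> {1..<N}" for k l
    using 1 that by (intro Max_ratio_leD[of "\<lambda>k. m k l" n]) (simp_all only: of_nat_add of_nat_1 diff_le_eq)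
  \<comment> \<open>The constant C collects the factors produced by differentiating the
    powers.\<close>
  moreover have "(\<Prod>l<N. real (M l + 1)) > 0"
    by (intro prod_pos) auto
  ultimately show ?case
    using 1 by (intro exI[of _ "\<Prod>l<N. real (M l + 1)"] conjI allI impI ballI
        spherical_deriv_prod_le) auto
next
  case (2 n m M\<^sub>0)
  have m: "m k \<le> k * (M\<^sub>0 + 2)" if "k \<in> {1..n}" for k
    using 2 that by (intro Max_ratio_leD[of m n]) (simp_all only: of_nat_add of_nat_numeral)
  show ?case
  proof (intro exI[of _ "real (M\<^sub>0 + 1)"] conjI allI impI ballI)
    fix a f z
    assume a: "(\<forall>k\<in>{1..n}. \<forall>j\<in>{0..m k}. a k j analytic_on ball 0 1) \<and>
      meromorphic_solution_first_order n m a f" and z: "z \<in> ball (0 :: complex) 1"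
    have "(\<Prod>l<1. spherical_deriv (\<lambda>w. ((deriv ^^ l) f w) ^ (M\<^sub>0 + 1)) z) \<le>
      (\<Prod>l<1::nat. real (M\<^sub>0 + 1)) *
        (\<Sum>k=1..n. \<Sum>j\<in>multi_indices 1 (\<lambda>l. m k). norm (a k (j 0) z) powr (1 / real k))"
      by (rule spherical_deriv_prod_le[where M = "\<lambda>l. M\<^sub>0" and m = "\<lambda>k l. m k"
            and a = "\<lambda>k j. a k (j 0)"])
        (use a m z in \<open>auto simp: meromorphic_solution_first_order_iff multi_indices_def
            dest!: PiE_mem[of _ _ _ 0]\<close>)
    then show "spherical_deriv (\<lambda>w. (f w) ^ (M\<^sub>0 + 1)) z
        \<le> real (M\<^sub>0 + 1) * (\<Sum>k=1..n. \<Sum>j=0..m k. norm (a k j z) powr (1 / real k))"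
      using sum_multi_indices_one[where \<mu> = "\<lambda>l. m k"
          and F = "\<lambda>i. norm (a k i z) powr (1 / real k)" for k]
      by simp
  qed simp
qed

end
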